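(* Let $r \ge 2$ be an integer and $\mathbf{m} = [m_2, m_3, \ldots]$ a type. Let $\mathbf{S} = \sum_{\mathbf{n} \ge 0} C_{\mathbf{n}} \mathbf{t}^{\mathbf{n}}$, where $C_{\mathbf{n}}$ is the number of subdigons of type $\mathbf{n}$, and let $C^{(r)}_{\mathbf{m}} = [\mathbf{t}^{\mathbf{m}}]\mathbf{S}^r$. Then $C^{(r)}_{\mathbf{m}}$ equals the number of subdigons of type $\mathbf{m} + \vec{r}$ whose central polygon is an $(r+1)$-gon, where $\vec{r}$ is the type with $1$ in position $r$ (i.e. $m_r$ increased by one) and $0$ elsewhere.
   Context: A type is a vector $\mathbf{m} = [m_2, m_3, \ldots]$ of nonnegative integers with finitely many nonzero entries; $\mathbf{t}^{\mathbf{m}} = \prod_{k\ge2} t_k^{m_k}$ in formal power series in $t_2, t_3, \ldots$. Let $V_{\mathbf{m}} = 2 + \sum_{k\ge2}(k-1)m_k$. A subdigon of type $\mathbf{m}$ is a subdivision of a fixed convex polygon with $V_{\mathbf{m}}$ labeled vertices, one of whose sides is distinguished as the roof, by pairwise non-crossing diagonals into exactly $m_k$ faces that are $(k+1)$-gons for each $k \ge 2$ (two subdigons are the same iff they use the same set of diagonals); for the zero type the unique subdigon is the null subdigon, a single edge. The central polygon of a non-null subdigon is the face having the roof as a side. *)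

theory Defs
  imports Main "HOL-Library.Poly_Mapping"
begin

text \<open>A type \<open>[m\<^sub>2, m\<^sub>3, \<dots>]\<close> is a finitely supported function on the natural
  numbers that vanishes at 0 and 1.\<close>

definition is_type :: "(nat \<Rightarrow>\<^sub>0 nat) \<Rightarrow> bool" where
  "is_type m \<longleftrightarrow> Poly_Mapping.keys m \<subseteq> {2..}"

definition num_vertices :: "(nat \<Rightarrow>\<^sub>0 nat) \<Rightarrow> nat" where
  "num_vertices m = 2 + (\<Sum>k\<in>Poly_Mapping.keys m. (k - 1) * Poly_Mapping.lookup m k)"

text \<open>The vertices of a convex \<open>V\<close>-gon are labelled \<open>0, \<dots>, V - 1\<close> in cyclic order. A finite set
  \<open>F\<close> of vertices stands for the convex polygon they span, and the segment between vertices
  \<open>i < j\<close> is the pair \<open>(i, j)\<close>. It is a side of \<open>F\<close> iff no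
  further vertex of \<open>F\<close> lies beyond it on one of the two arcs from \<open>i\<close> to \<open>j\<close>.\<close>

definition sides :: "nat set \<Rightarrow> (nat \<times> nat) set" where
  "sides F = {(i, j). i \<in> F \<and> j \<in> F \<and> i < j \<and>
     ((\<forall>k\<in>F. \<not> (i < k \<and> k < j)) \<or> (\<forall>k\<in>F. i \<le> k \<and> k \<le> j))}"

definition diagonals :: "nat set \<Rightarrow> (nat \<times> nat) set" where
  "diagonals F = {(i, j). i \<in> F \<and> j \<in> F \<and> i < j} - sides F"

definition crossing :: "nat \<times> nat \<Rightarrow> nat \<times> nat \<Rightarrow> bool" where
  "crossing d e \<longleftrightarrow>
     fst d < fst e \<and> fst e < snd d \<and> snd d < snd e \<or>
     fst e < fst d \<and> fst d < snd e \<and> snd e < snd d"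

definition roof :: "nat \<Rightarrow> nat \<times> nat" where
  "roof V = (0, V - 1)"

definition dissection :: "nat \<Rightarrow> (nat \<times> nat) set \<Rightarrow> bool" where
  "dissection V D \<longleftrightarrow> D \<subseteq> diagonals {..<V} \<and> (\<forall>d\<in>D. \<forall>e\<in>D. \<not> crossing d e)"

text \<open>The faces of a dissection are the polygons bounded by sides of the big polygon and
  diagonals of the dissection that are not cut any further.\<close>

definition faces :: "nat \<Rightarrow> (nat \<times> nat) set \<Rightarrow> nat set set" where
  "faces V D = {F. F \<subseteq> {..<V} \<and> 3 \<le> card F \<and>
     sides F \<subseteq> sides {..<V} \<union> D \<and> diagonals F \<inter> D = {}}"

text \<open>For the zero type there are two vertices, no diagonals and no faces, so the empty set
  of diagonals is the null subdigon.\<close>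

definition subdigons :: "(nat \<Rightarrow>\<^sub>0 nat) \<Rightarrow> (nat \<times> nat) set set" where
  "subdigons m = {D. dissection (num_vertices m) D \<and>
     (\<forall>k\<ge>2. card {F \<in> faces (num_vertices m) D. card F = k + 1} = Poly_Mapping.lookup m k)}"

definition central_polygon :: "nat \<Rightarrow> (nat \<times> nat) set \<Rightarrow> nat set" where
  "central_polygon V D = (THE F. F \<in> faces V D \<and> roof V \<in> sides F)"

text \<open>A formal power series in the variables \<open>t\<^sub>k\<close> is the function from exponent vectors to
  coefficients.\<close>

type_synonym 'a mfps = "(nat \<Rightarrow>\<^sub>0 nat) \<Rightarrow> 'a"

definition mfps_one :: "'a::comm_semiring_1 mfps" where
  "mfps_one m = (if m = 0 then 1 else 0)"

definition mfps_mult :: "'a::comm_semiring_1 mfps \<Rightarrow> 'a mfps \<Rightarrow> 'a mfps" where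
  "mfps_mult f g m = (\<Sum>(a, b) | a + b = m. f a * g b)"

primrec mfps_power :: "'a::comm_semiring_1 mfps \<Rightarrow> nat \<Rightarrow> 'a mfps" where
  "mfps_power f 0 = mfps_one"
| "mfps_power f (Suc n) = mfps_mult f (mfps_power f n)"

text \<open>The sum in the Cauchy product is over a finite set.\<close>

lemma finite_splittings: "finite {(a, b). a + b = (m :: nat \<Rightarrow>\<^sub>0 nat)}"
proof -
  let ?B = "{h. \<forall>k. (k \<in> Poly_Mapping.keys m \<longrightarrow> h k \<in> {..Max (range (Poly_Mapping.lookup m))}) \<and>
    (k \<notin> Poly_Mapping.keys m \<longrightarrow> h k = (0::nat))}"
  have fin: "finite (range (Poly_Mapping.lookup m))"
    by (rule finite_subset[of _ "insert 0 (Poly_Mapping.lookup m ` Poly_Mapping.keys m)"])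
       (auto simp: in_keys_iff)
  have "finite ?B"
    by (rule finite_set_of_finite_funs) auto
  moreover have "Poly_Mapping.lookup ` {a. \<exists>b. a + b = m \<or> b + a = m} \<subseteq> ?B"
  proof (rule image_subsetI, elim CollectE exE)
    fix a b assume ab: "a + b = m \<or> b + a = m"
    have le: "Poly_Mapping.lookup a k \<le> Poly_Mapping.lookup m k" for k
      using ab by (auto simp: lookup_add)
    have "Poly_Mapping.lookup a k \<le> Max (range (Poly_Mapping.lookup m))" for k
      using le[of k] Max_ge[OF fin, of "Poly_Mapping.lookup m k"] by auto
    moreover have "Poly_Mapping.lookup a k = 0" if "k \<notin> Poly_Mapping.keys m" for k
      using le[of k] that by (simp add: in_keys_iff)
    ultimately show "Poly_Mapping.lookup a \<in> ?B"
      by simp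
  qed
  ultimately have "finite (Poly_Mapping.lookup ` {a. \<exists>b. a + b = m \<or> b + a = m})"
    by (rule rev_finite_subset)
  then have "finite {a. \<exists>b. a + b = m \<or> b + a = m}"
    by (rule finite_imageD) (simp add: inj_on_def lookup_inject)
  then have "finite ({a. \<exists>b. a + b = m \<or> b + a = m} \<times> {a. \<exists>b. a + b = m \<or> b + a = m})"
    by simp
  then show ?thesis
    by (rule rev_finite_subset) auto
qed

text \<open>Exponent vectors involving \<open>t\<^sub>0\<close> or \<open>t\<^sub>1\<close> are not types and do not occur in the series.\<close>

definition subdigon_series :: "nat mfps" where
  "subdigon_series n = (if is_type n then card (subdigons n) else 0)"

end

theory Submission
  imports Defs
begin

text \<open>Adding the sides of the polygon to a subdigon gives a non-crossing set \<open>E\<close> of segments on an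
  interval \<open>{a..b}\<close> that contains all unit segments, and the faces can be read off from \<open>E\<close> alone.
  The vertices over which no segment of \<open>E\<close> passes form a path from \<open>a\<close> to \<open>b\<close>, the spine. If the
  roof belongs to \<open>E\<close>, then the spine is just the roof, and deleting the roof
  turns the spine into the outline of the central polygon. So the subdigons with a central
  \<open>(r + 1)\<close>-gon correspond to the systems whose spine has \<open>r\<close> steps. Cutting such a system at the
  second spine vertex leaves a subdigon and a system whose spine has \<open>r - 1\<close> steps, which is the
  recursion for the powers of the series. That the sizes of the two intervals agree with the types
  of the two parts is Euler's relation \<open>b - a = r + (\<Sum>k. (k - 1) * m\<^sub>k)\<close>.\<close>

definition segments :: "nat set \<Rightarrow> (nat \<times> nat) set" where
  "segments F = {(i, j). i \<in> F \<and> j \<in> F \<and> i < j}"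

text \<open>The pairs of consecutive elements of \<open>F\<close>. For at least three vertices these
  are the sides other than the one joining the least to the greatest vertex.\<close>

definition steps :: "nat set \<Rightarrow> (nat \<times> nat) set" where
  "steps F = {(i, j). i \<in> F \<and> j \<in> F \<and> i < j \<and> (\<forall>k\<in>F. \<not> (i < k \<and> k < j))}"

text \<open>The roof \<open>(a, b)\<close> may be present or absent, so that it can be added and
  deleted and systems can be concatenated at an endpoint. The degenerate case \<open>a = b\<close>
  forces \<open>E = {}\<close> and serves as the unit of concatenation.\<close>

definition arc_system :: "nat \<Rightarrow> nat \<Rightarrow> (nat \<times> nat) set \<Rightarrow> bool" where
  "arc_system a b E \<longleftrightarrow> a \<le> b \<and> E \<subseteq> segments {a..b} \<and> steps {a..b} \<subseteq> E \<and>
     (\<forall>d\<in>E. \<forall>e\<in>E. \<not> crossing d e)"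

definition spine :: "nat \<Rightarrow> nat \<Rightarrow> (nat \<times> nat) set \<Rightarrow> nat set" where
  "spine a b E = {c \<in> {a..b}. \<forall>(i, j)\<in>E. \<not> (i < c \<and> c < j)}"

text \<open>The single equation says both that every side of \<open>F\<close> is in \<open>E\<close>
  and that no diagonal is. No ambient polygon occurs, so faces stay comparable when \<open>E\<close>
  is cut or enlarged.\<close>

definition polys :: "(nat \<times> nat) set \<Rightarrow> nat set set" where
  "polys E = {F. 3 \<le> card F \<and> segments F \<inter> E = sides F}"

text \<open>A face with \<open>k + 1\<close> vertices contributes to the variable with index
  \<open>k\<close>, hence the \<open>card F - 1\<close>.\<close>

definition face_type :: "(nat \<times> nat) set \<Rightarrow> (nat \<Rightarrow>\<^sub>0 nat)" where
  "face_type E = (\<Sum>F\<in>polys E. Poly_Mapping.single (card F - 1) 1)"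

definition weight :: "(nat \<Rightarrow>\<^sub>0 nat) \<Rightarrow> nat" where
  "weight n = (\<Sum>k\<in>Poly_Mapping.keys n. (k - 1) * Poly_Mapping.lookup n k)"

text \<open>The length of the interval is the one forced by Euler's relation.\<close>

definition systems :: "nat \<Rightarrow> nat \<Rightarrow> (nat \<Rightarrow>\<^sub>0 nat) \<Rightarrow> (nat \<times> nat) set set" where
  "systems r a n = {E. arc_system a (a + r + weight n) E \<and>
     card (spine a (a + r + weight n) E) = r + 1 \<and> face_type E = n}"

section \<open>Additivity of the weight of a type\<close>

lemma num_vertices_eq_weight: "num_vertices n = 2 + weight n"
  by (simp add: num_vertices_def weight_def)

lemma weight_superset:
  assumes "finite S" "Poly_Mapping.keys n \<subseteq> S"
  shows "weight n = (\<Sum>k\<in>S. (k - 1) * Poly_Mapping.lookup n k)"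
  unfolding weight_def using assms
  by (intro sum.mono_neutral_left) (auto simp: in_keys_iff)

lemma weight_zero [simp]: "weight 0 = 0"
  by (simp add: weight_def)

lemma weight_add [simp]: "weight (m + n) = weight m + weight n"
proof -
  let ?S = "Poly_Mapping.keys m \<union> Poly_Mapping.keys n"
  have "weight (m + n) = (\<Sum>k\<in>?S. (k - 1) * Poly_Mapping.lookup (m + n) k)"
    by (rule weight_superset) (use keys_add[of m n] in auto)
  moreover have "weight m = (\<Sum>k\<in>?S. (k - 1) * Poly_Mapping.lookup m k)"
    by (rule weight_superset) auto
  moreover have "weight n = (\<Sum>k\<in>?S. (k - 1) * Poly_Mapping.lookup n k)"
    by (rule weight_superset) auto
  ultimately show ?thesis
    by (simp add: lookup_add distrib_left sum.distrib)
qed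

lemma weight_single [simp]: "weight (Poly_Mapping.single r (Suc 0)) = r - 1"
  by (simp add: weight_def)

section \<open>Segments, sides and steps of a vertex set\<close>

lemma diagonals_eq: "diagonals F = segments F - sides F"
  by (auto simp: diagonals_def segments_def)

lemma steps_subset_sides: "steps F \<subseteq> sides F"
  by (auto simp: steps_def sides_def)

lemma sides_subset_segments: "sides F \<subseteq> segments F"
  by (auto simp: segments_def sides_def)

text \<open>If all of \<open>F\<close> lies between \<open>i\<close> and \<open>j\<close>, these are
  its extreme vertices, so the second alternative in \<open>sides\<close> contributes only
  \<open>(a, b)\<close>.\<close>

lemma sides_eq_insert_steps:
  assumes "a \<in> F" "b \<in> F" "F \<subseteq> {a..b}" "a < b"
  shows "sides F = insert (a, b) (steps F)"
proof -
  have "(i, j) = (a, b)" if "i \<in> F" "j \<in> F" "\<forall>k\<in>F. i \<le> k \<and> k \<le> j" for i j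
  proof -
    have "i \<le> a" "b \<le> j" using that assms(1,2) by auto
    moreover have "a \<le> i" "j \<le> b" using that(1,2) assms(3) by auto
    ultimately show ?thesis by simp
  qed
  then have "sides F \<subseteq> insert (a, b) (steps F)"
    unfolding sides_def steps_def by blast
  moreover have "(a, b) \<in> sides F" using assms by (auto simp: sides_def)
  ultimately show ?thesis using steps_subset_sides by blast
qed

lemma steps_interval: "steps {a..b} = {(i, j). a \<le> i \<and> j \<le> b \<and> j = Suc i}"
proof -
  have "(i, j) \<in> steps {a..b} \<longleftrightarrow> a \<le> i \<and> j \<le> b \<and> j = Suc i" for i j
  proof
    assume *: "(i, j) \<in> steps {a..b}"
    then have "\<not> (i < Suc i \<and> Suc i < j)" by (fastforce simp: steps_def)
    then show "a \<le> i \<and> j \<le> b \<and> j = Suc i" using * by (auto simp: steps_def)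
  qed (auto simp: steps_def)
  then show ?thesis by auto
qed

lemma sides_interval:
  "a < b \<Longrightarrow> sides {a..b} = insert (a, b) {(i, j). a \<le> i \<and> j \<le> b \<and> j = Suc i}"
  using sides_eq_insert_steps[of a "{a..b}" b] by (simp add: steps_interval)

text \<open>The step runs from the last element of \<open>F\<close> up to \<open>x\<close> to the
  first one beyond \<open>x\<close>. It is half-open: \<open>x\<close> itself may be its left
  end.\<close>

lemma ex_step_over:
  assumes "finite F" "a \<in> F" "b \<in> F" "a \<le> x" "x < b"
  obtains p q where "(p, q) \<in> steps F" "p \<le> x" "x < q"
proof -
  let ?A = "{y\<in>F. y \<le> x}" and ?B = "{y\<in>F. x < y}"
  have A: "finite ?A" "?A \<noteq> {}" and B: "finite ?B" "?B \<noteq> {}" using assms by auto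
  have "Max ?A \<in> ?A" "Min ?B \<in> ?B" using Max_in[OF A] Min_in[OF B] by auto
  moreover have "\<not> (Max ?A < k \<and> k < Min ?B)" if "k \<in> F" for k
  proof (cases "k \<le> x")
    case True
    then have "k \<le> Max ?A" using Max_ge[OF A(1)] that by simp
    then show ?thesis by simp
  next
    case False
    then have "Min ?B \<le> k" using Min_le[OF B(1)] that by simp
    then show ?thesis by simp
  qed
  ultimately show ?thesis using that[of "Max ?A" "Min ?B"] by (auto simp: steps_def)
qed

section \<open>Arc systems in terms of pairs of endpoints\<close>

lemma arc_systemD:
  assumes "arc_system a b E"
  shows "a \<le> b" "\<And>i j. (i, j) \<in> E \<Longrightarrow> a \<le> i \<and> i < j \<and> j \<le> b"
    "\<And>i. a \<le> i \<Longrightarrow> i < b \<Longrightarrow> (i, Suc i) \<in> E"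
    "\<And>i j k l. (i, j) \<in> E \<Longrightarrow> (k, l) \<in> E \<Longrightarrow> i < k \<Longrightarrow> k < j \<Longrightarrow> j < l \<Longrightarrow> False"
proof -
  show "a \<le> b" using assms by (simp add: arc_system_def)
  show "a \<le> i \<and> i < j \<and> j \<le> b" if "(i, j) \<in> E" for i j
    using assms that by (auto simp: arc_system_def segments_def)
  show "(i, Suc i) \<in> E" if "a \<le> i" "i < b" for i
    using assms that by (auto simp: arc_system_def steps_interval)
  show False if "(i, j) \<in> E" "(k, l) \<in> E" "i < k" "k < j" "j < l" for i j k l
  proof -
    have "crossing (i, j) (k, l)" using that by (simp add: crossing_def)
    then show False using assms that unfolding arc_system_def by blast
  qed
qed

text \<open>One orientation of a crossing is enough to check, since \<open>crossing\<close> is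
  symmetric and \<open>d\<close>, \<open>e\<close> range over all ordered pairs.\<close>

lemma arc_systemI:
  assumes "a \<le> b" "\<And>i j. (i, j) \<in> E \<Longrightarrow> a \<le> i \<and> i < j \<and> j \<le> b"
    "\<And>i. a \<le> i \<Longrightarrow> i < b \<Longrightarrow> (i, Suc i) \<in> E"
    "\<And>i j k l. (i, j) \<in> E \<Longrightarrow> (k, l) \<in> E \<Longrightarrow> i < k \<Longrightarrow> k < j \<Longrightarrow> j < l \<Longrightarrow> False"
  shows "arc_system a b E"
  unfolding arc_system_def
proof (intro conjI ballI)
  show "E \<subseteq> segments {a..b}" using assms(2) by (force simp: segments_def)
  show "steps {a..b} \<subseteq> E" using assms(3) by (auto simp: steps_interval)
  fix d e assume "d \<in> E" "e \<in> E"
  then show "\<not> crossing d e"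
    using assms(4)[of "fst d" "snd d" "fst e" "snd e"] assms(4)[of "fst e" "snd e" "fst d" "snd d"]
    by (auto simp: crossing_def)
qed (rule assms(1))

lemma arc_system_finite: "arc_system a b E \<Longrightarrow> finite E"
  by (rule finite_subset[of _ "{a..b} \<times> {a..b}"]) (auto simp: arc_system_def segments_def)

section \<open>The spine as a path of segments\<close>

lemma spine_subset: "spine a b E \<subseteq> {a..b}"
  by (auto simp: spine_def)

lemma finite_spine: "finite (spine a b E)"
  by (rule finite_subset[OF spine_subset]) simp

lemma ends_in_spine:
  assumes "arc_system a b E"
  shows "a \<in> spine a b E" "b \<in> spine a b E"
  using arc_systemD(1)[OF assms] arc_systemD(2)[OF assms] unfolding spine_def
  by (auto dest: leD)

text \<open>A segment of \<open>E\<close> cannot pass over a spine vertex, so between spine vertices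
  only steps can occur. Conversely, the longest segment of \<open>E\<close> starting at a spine
  vertex ends in the next spine vertex.\<close>

lemma segments_spine_inter:
  assumes E: "arc_system a b E"
  shows "segments (spine a b E) \<inter> E = steps (spine a b E)"
proof (intro equalityI subrelI)
  fix i j assume "(i, j) \<in> segments (spine a b E) \<inter> E"
  then show "(i, j) \<in> steps (spine a b E)"
    by (auto simp: segments_def steps_def spine_def)
next
  fix i j assume ij: "(i, j) \<in> steps (spine a b E)"
  then have i: "i \<in> spine a b E" and j: "j \<in> spine a b E" "i < j"
    and nb: "\<And>k. k \<in> spine a b E \<Longrightarrow> \<not> (i < k \<and> k < j)"
    by (auto simp: steps_def)
  let ?Y = "{y. (i, y) \<in> E}"
  have "?Y \<subseteq> {..b}" using arc_systemD(2)[OF E] by auto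
  then have fin: "finite ?Y" by (rule finite_subset) simp
  have "(i, Suc i) \<in> E" using i j arc_systemD(3)[OF E, of i] by (auto simp: spine_def)
  then have ne: "?Y \<noteq> {}" by auto
  \<comment> \<open>The far end of the longest segment starting at \<open>i\<close>. It will turn
    out to be \<open>j\<close>.\<close>
  define y where "y = Max ?Y"
  have yE: "(i, y) \<in> E" using Max_in[OF fin ne] by (simp add: y_def)
  have ymax: "z \<le> y" if "(i, z) \<in> E" for z using Max_ge[OF fin, of z] that by (simp add: y_def)
  have "y \<in> spine a b E"
  proof -
    have False if pq: "(p, q) \<in> E" "p < y" "y < q" for p q
    proof -
      have "i < y" using arc_systemD(2)[OF E yE] by simp
      \<comment> \<open>A segment over \<open>y\<close> cannot start before \<open>i\<close>, which
        is a spine vertex. Starting at \<open>i\<close> it would be longer than the longest one, and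
        starting between \<open>i\<close> and \<open>y\<close> it would cross
        \<open>(i, y)\<close>.\<close>
      then have "\<not> p < i" using i pq by (auto simp: spine_def)
      then have "i \<le> p" by simp
      then show False using ymax[of q] pq arc_systemD(4)[OF E yE pq(1)]
        by (cases "i = p") auto
    qed
    then show ?thesis using arc_systemD(2)[OF E yE] by (auto simp: spine_def)
  qed
  then have "j \<le> y" using nb[of y] arc_systemD(2)[OF E yE] by auto
  moreover have "y \<le> j" using j yE by (auto simp: spine_def)
  ultimately show "(i, j) \<in> segments (spine a b E) \<inter> E"
    using yE i j by (auto simp: segments_def)
qed

text \<open>If a segment \<open>(i, j)\<close> of \<open>E\<close> passed over \<open>c\<close> in
  \<open>F\<close>, then non-crossing would force the steps of \<open>F\<close> above its two ends
  to start at \<open>i\<close> and to end at \<open>j\<close>. So \<open>(i, j)\<close> would be a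
  segment of \<open>F\<close> in \<open>E\<close> that is not a step. Conversely, a spine vertex
  missing from \<open>F\<close> would lie strictly under a step of \<open>F\<close>, which is in
  \<open>E\<close>.\<close>

lemma spine_unique:
  assumes E: "arc_system a b E" and F: "a \<in> F" "b \<in> F" "F \<subseteq> {a..b}"
    and eq: "segments F \<inter> E = steps F"
  shows "F = spine a b E"
proof (intro equalityI subsetI)
  have fin: "finite F" using F(3) by (rule finite_subset) simp
  fix c assume c: "c \<in> F"
  have False if ij: "(i, j) \<in> E" "i < c" "c < j" for i j
  proof -
    have ab: "a \<le> i" "j \<le> b" using arc_systemD(2)[OF E ij(1)] by auto
    have "i < b" using ab ij by simp
    with ab obtain x y where xy: "(x, y) \<in> steps F" "x \<le> i" "i < y"
      using ex_step_over[OF fin F(1,2)] by metis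
    \<comment> \<open>Since steps are taken half-open, the point \<open>j - 1\<close> yields the
      step with \<open>u < j\<close> and \<open>j \<le> v\<close>.\<close>
    have "a \<le> j - 1" "j - 1 < b" using ab ij by auto
    then obtain u v where uv: "(u, v) \<in> steps F" "u \<le> j - 1" "j - 1 < v"
      using ex_step_over[OF fin F(1,2)] by metis
    have E': "(x, y) \<in> E" "(u, v) \<in> E" using xy uv eq by auto
    have "\<not> (x < c \<and> c < y)" using xy c by (auto simp: steps_def)
    then have "y \<le> c" using xy ij by auto
    then have "x = i" using arc_systemD(4)[OF E E'(1) ij(1)] xy ij by force
    have "\<not> (u < c \<and> c < v)" using uv c by (auto simp: steps_def)
    then have "c \<le> u" using uv ij by auto
    then have "v = j" using arc_systemD(4)[OF E ij(1) E'(2)] uv ij by force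
    have "(i, j) \<in> segments F \<inter> E"
      using \<open>x = i\<close> \<open>v = j\<close> xy uv ij by (auto simp: segments_def steps_def)
    then show False using eq ij c by (auto simp: steps_def)
  qed
  then show "c \<in> spine a b E" using c F by (auto simp: spine_def)
next
  have fin: "finite F" using F(3) by (rule finite_subset) simp
  fix c assume c: "c \<in> spine a b E"
  show "c \<in> F"
  proof (rule ccontr)
    assume nc: "c \<notin> F"
    then have "a \<le> c" "c < b" using c F by (auto simp: spine_def le_less)
    then obtain p q where pq: "(p, q) \<in> steps F" "p \<le> c" "c < q"
      using ex_step_over[OF fin F(1,2)] by metis
    then have "p < c" using nc by (auto simp: steps_def le_less)
    moreover have "(p, q) \<in> E" using pq eq by auto
    ultimately show False using c pq by (auto simp: spine_def)
  qed
qed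

section \<open>Faces and where they lie\<close>

text \<open>The segment joining the extreme vertices of a face is one of its sides, hence in
  \<open>E\<close>. It encloses the whole face and so locates it.\<close>

lemma polys_subset:
  assumes E: "arc_system a b E" and F: "F \<in> polys E"
  shows "F \<subseteq> {a..b}" "(Min F, Max F) \<in> E"
proof -
  have "3 \<le> card F" using F by (simp add: polys_def)
  then have fin: "finite F" "F \<noteq> {}" by (auto intro: card_ge_0_finite)
  have "Min F \<noteq> Max F"
  proof
    assume "Min F = Max F"
    then have "F \<subseteq> {Min F}" using fin by (metis Max_ge Min_le le_antisym singletonI subsetI)
    then have "card F \<le> 1" using card_mono[of "{Min F}" F] by simp
    then show False using \<open>3 \<le> card F\<close> by simp
  qed
  moreover have "Min F \<le> Max F" using fin by simp
  ultimately have "Min F < Max F" by simp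
  then have "(Min F, Max F) \<in> sides F" using fin by (auto simp: sides_def)
  then show M: "(Min F, Max F) \<in> E" using F by (auto simp: polys_def)
  show "F \<subseteq> {a..b}"
    using arc_systemD(2)[OF E M] fin by (meson Max_ge Min_le atLeastAtMost_iff le_trans subsetI)
qed

lemma finite_polys: "arc_system a b E \<Longrightarrow> finite (polys E)"
  by (rule finite_subset[of _ "Pow {a..b}"]) (use polys_subset(1) in blast, simp)

section \<open>Concatenating two systems at a common endpoint\<close>

lemma arc_system_union:
  assumes L: "arc_system a c L" and R: "arc_system c b R"
  shows "arc_system a b (L \<union> R)"
proof (rule arc_systemI)
  show "a \<le> b" using arc_systemD(1)[OF L] arc_systemD(1)[OF R] by simp
  show "a \<le> i \<and> i < j \<and> j \<le> b" if "(i, j) \<in> L \<union> R" for i j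
    using that arc_systemD(1)[OF L] arc_systemD(1)[OF R] arc_systemD(2)[OF L, of i j]
      arc_systemD(2)[OF R, of i j] by auto
  show "(i, Suc i) \<in> L \<union> R" if "a \<le> i" "i < b" for i
    using that arc_systemD(3)[OF L] arc_systemD(3)[OF R] by (cases "i < c") auto
  show False if *: "(i, j) \<in> L \<union> R" "(k, l) \<in> L \<union> R" "i < k" "k < j" "j < l" for i j k l
  proof -
    consider "(i, j) \<in> L" "(k, l) \<in> L" | "(i, j) \<in> R" "(k, l) \<in> R"
      | "(i, j) \<in> L" "(k, l) \<in> R" | "(i, j) \<in> R" "(k, l) \<in> L"
      using * by blast
    then show False
    proof cases
      case 1 then show ?thesis using arc_systemD(4)[OF L] * by blast
    next
      case 2 then show ?thesis using arc_systemD(4)[OF R] * by blast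
    next
      case 3 then show ?thesis using arc_systemD(2)[OF L 3(1)] arc_systemD(2)[OF R 3(2)] * by simp
    next
      case 4 then show ?thesis using arc_systemD(2)[OF R 4(1)] arc_systemD(2)[OF L 4(2)] * by simp
    qed
  qed
qed

text \<open>The part containing the segment between the extreme vertices of a face contains the
  face, and the other part has no segment between its vertices. A face of both parts would be
  confined to the single vertex \<open>c\<close>.\<close>

lemma polys_union:
  assumes L: "arc_system a c L" and R: "arc_system c b R"
  shows "polys (L \<union> R) = polys L \<union> polys R" "polys L \<inter> polys R = {}"
proof -
  have l: "segments F \<inter> R = {}" if "F \<subseteq> {a..c}" for F
  proof -
    have "(i, j) \<notin> R" if "i \<in> F" "j \<in> F" for i j
      using that \<open>F \<subseteq> {a..c}\<close> arc_systemD(2)[OF R, of i j] by auto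
    then show ?thesis by (auto simp: segments_def)
  qed
  have r: "segments F \<inter> L = {}" if "F \<subseteq> {c..b}" for F
  proof -
    have "(i, j) \<notin> L" if "i \<in> F" "j \<in> F" for i j
      using that \<open>F \<subseteq> {c..b}\<close> arc_systemD(2)[OF L, of i j] by auto
    then show ?thesis by (auto simp: segments_def)
  qed
  note LR = arc_system_union[OF L R]
  show "polys (L \<union> R) = polys L \<union> polys R"
  proof (intro equalityI subsetI)
    fix F assume F: "F \<in> polys (L \<union> R)"
    have "F \<subseteq> {a..b}" and M: "(Min F, Max F) \<in> L \<union> R" using polys_subset[OF LR F] by auto
    have fin: "finite F" "F \<noteq> {}" using F by (auto simp: polys_def intro: card_ge_0_finite)
    from M show "F \<in> polys L \<union> polys R"
    proof
      assume "(Min F, Max F) \<in> L"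
      then have "F \<subseteq> {a..c}" using arc_systemD(2)[OF L] fin
        by (meson Max_ge Min_le atLeastAtMost_iff le_trans subsetI)
      from l[OF this] F show ?thesis by (auto simp: polys_def Int_Un_distrib)
    next
      assume "(Min F, Max F) \<in> R"
      then have "F \<subseteq> {c..b}" using arc_systemD(2)[OF R] fin
        by (meson Max_ge Min_le atLeastAtMost_iff le_trans subsetI)
      from r[OF this] F show ?thesis by (auto simp: polys_def Int_Un_distrib)
    qed
  next
    fix F assume "F \<in> polys L \<union> polys R"
    then show "F \<in> polys (L \<union> R)"
      using l[of F] r[of F] polys_subset(1)[OF L, of F] polys_subset(1)[OF R, of F]
      by (auto simp: polys_def Int_Un_distrib)
  qed
  show "polys L \<inter> polys R = {}"
  proof (rule ccontr)
    assume "polys L \<inter> polys R \<noteq> {}"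
    then obtain F where F: "F \<in> polys L" "F \<in> polys R" by auto
    then have "F \<subseteq> {c}" using polys_subset(1)[OF L F(1)] polys_subset(1)[OF R F(2)] by fastforce
    then have "card F \<le> 1" using card_mono[of "{c}" F] by simp
    then show False using F by (simp add: polys_def)
  qed
qed

lemma face_type_union:
  assumes "arc_system a c L" "arc_system c b R"
  shows "face_type (L \<union> R) = face_type L + face_type R"
  unfolding face_type_def polys_union(1)[OF assms]
  by (rule sum.union_disjoint) (use assms finite_polys polys_union(2)[OF assms] in auto)

text \<open>The segment \<open>(a, c)\<close> passes over every vertex strictly between
  \<open>a\<close> and \<open>c\<close>, so the left part adds only \<open>a\<close>.\<close>

lemma spine_union:
  assumes L: "arc_system a c L" "(a, c) \<in> L" and R: "arc_system c b R"
  shows "spine a b (L \<union> R) = insert a (spine c b R)"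
proof -
  have ac: "a < c" "c \<le> b" using arc_systemD(2)[OF L] arc_systemD(1)[OF R] by auto
  show ?thesis
  proof (intro equalityI subsetI)
    fix x assume x: "x \<in> spine a b (L \<union> R)"
    then have "\<not> (a < x \<and> x < c)" "a \<le> x" using L(2) by (auto simp: spine_def)
    then have "x = a \<or> c \<le> x" by auto
    then show "x \<in> insert a (spine c b R)" using x by (auto simp: spine_def)
  next
    fix x assume x: "x \<in> insert a (spine c b R)"
    have "\<not> (i < x \<and> x < j)" if "(i, j) \<in> L \<union> R" for i j
      using that x arc_systemD(2)[OF L(1), of i j] arc_systemD(2)[OF R, of i j] ac
      by (auto simp: spine_def)
    then show "x \<in> spine a b (L \<union> R)" using x ac by (auto simp: spine_def)
  qed
qed

section \<open>Cutting a system at a spine vertex\<close>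

lemma spine_eq_ends:
  assumes "arc_system a b E" "(a, b) \<in> E"
  shows "spine a b E = {a, b}"
proof -
  have "x = a \<or> x = b" if "x \<in> spine a b E" for x
  proof -
    have "\<not> (a < x \<and> x < b)" "a \<le> x" "x \<le> b" using that assms(2) by (auto simp: spine_def)
    then show ?thesis by auto
  qed
  then show ?thesis using ends_in_spine[OF assms(1)] by auto
qed

text \<open>This makes presence of the roof a condition on the spine: systems with a roof are those
  whose spine has one step. The spine \<open>{a, b}\<close> has \<open>(a, b)\<close> as its step,
  and steps of the spine are in \<open>E\<close>.\<close>

lemma card_spine_eq_2_iff:
  assumes E: "arc_system a b E" and "a < b"
  shows "card (spine a b E) = 2 \<longleftrightarrow> (a, b) \<in> E"
proof
  assume "card (spine a b E) = 2"
  then have "spine a b E = {a, b}"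
    using ends_in_spine[OF E] \<open>a < b\<close> finite_spine
    by (intro card_subset_eq[symmetric]) auto
  then have "(a, b) \<in> steps (spine a b E)" using \<open>a < b\<close> by (auto simp: steps_def)
  then show "(a, b) \<in> E" using segments_spine_inter[OF E] by auto
next
  assume "(a, b) \<in> E"
  then show "card (spine a b E) = 2" using spine_eq_ends[OF E] \<open>a < b\<close> by simp
qed

lemma card_spine_ge_2:
  assumes E: "arc_system a b E" and "a < b"
  shows "2 \<le> card (spine a b E)"
proof -
  have "card {a, b} \<le> card (spine a b E)"
    using ends_in_spine[OF E] by (intro card_mono finite_spine) auto
  then show ?thesis using \<open>a < b\<close> by simp
qed

text \<open>No segment passes over a spine vertex, so each one lies entirely to its left or to its
  right.\<close>

lemma arc_system_split:
  assumes E: "arc_system a b E" and c: "c \<in> spine a b E"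
  shows "arc_system a c {(i, j) \<in> E. j \<le> c}" "arc_system c b {(i, j) \<in> E. c \<le> i}"
    "E = {(i, j) \<in> E. j \<le> c} \<union> {(i, j) \<in> E. c \<le> i}"
proof -
  note D = arc_systemD[OF E]
  have ac: "a \<le> c" "c \<le> b" using c by (auto simp: spine_def)
  show "arc_system a c {(i, j) \<in> E. j \<le> c}"
  proof (rule arc_systemI)
    show False if "(i, j) \<in> {(i, j) \<in> E. j \<le> c}" "(k, l) \<in> {(i, j) \<in> E. j \<le> c}"
      "i < k" "k < j" "j < l" for i j k l
      using that D(4)[of i j k l] by simp
  qed (use ac D(2,3) in auto)
  show "arc_system c b {(i, j) \<in> E. c \<le> i}"
  proof (rule arc_systemI)
    show False if "(i, j) \<in> {(i, j) \<in> E. c \<le> i}" "(k, l) \<in> {(i, j) \<in> E. c \<le> i}"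
      "i < k" "k < j" "j < l" for i j k l
      using that D(4)[of i j k l] by simp
  qed (use ac D(2,3) in auto)
  show "E = {(i, j) \<in> E. j \<le> c} \<union> {(i, j) \<in> E. c \<le> i}"
    using c by (auto simp: spine_def)
qed

text \<open>The cut is at the second spine vertex. The first step of the spine is in
  \<open>E\<close> and becomes the roof of the left part, which therefore is a subdigon.\<close>

lemma arc_system_split_first:
  assumes E: "arc_system a b E" and "a < b"
  obtains c L R where "E = L \<union> R" "arc_system a c L" "(a, c) \<in> L" "arc_system c b R"
proof -
  let ?S = "spine a b E - {a}"
  have S: "finite ?S" "?S \<noteq> {}" using ends_in_spine[OF E] \<open>a < b\<close> finite_spine by auto
  define c where "c = Min ?S"
  have c: "c \<in> spine a b E" "c \<noteq> a" using Min_in[OF S] by (auto simp: c_def)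
  then have "a < c" by (auto simp: spine_def)
  moreover have "c \<le> k" if "k \<in> spine a b E" "a < k" for k
    using Min_le[OF S(1), of k] that by (auto simp: c_def)
  ultimately have "(a, c) \<in> steps (spine a b E)"
    using c ends_in_spine(1)[OF E] by (fastforce simp: steps_def)
  then have "(a, c) \<in> E" using segments_spine_inter[OF E] by auto
  then show ?thesis
    using that[OF arc_system_split(3)[OF E c(1)] arc_system_split(1)[OF E c(1)] _ 
      arc_system_split(2)[OF E c(1)]] by auto
qed

section \<open>Adding and deleting the roof\<close>

lemma arc_system_insert_roof:
  assumes "arc_system a b E" "a < b"
  shows "arc_system a b (insert (a, b) E)"
proof (rule arc_systemI)
  note D = arc_systemD[OF assms(1)]
  show "a \<le> i \<and> i < j \<and> j \<le> b" if "(i, j) \<in> insert (a, b) E" for i j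
    using that assms(2) D(2)[of i j] by auto
  show False if "(i, j) \<in> insert (a, b) E" "(k, l) \<in> insert (a, b) E" "i < k" "k < j" "j < l" for i j k l
    using that D(2)[of i j] D(2)[of k l] D(4)[of i j k l] by auto
qed (use assms(2) arc_systemD(3)[OF assms(1)] in auto)

text \<open>For \<open>b = a + 1\<close> the roof is a unit segment, which an arc system has to
  contain.\<close>

lemma arc_system_remove_roof:
  assumes "arc_system a b E" "a + 2 \<le> b"
  shows "arc_system a b (E - {(a, b)})"
proof (rule arc_systemI)
  note D = arc_systemD[OF assms(1)]
  show "a \<le> i \<and> i < j \<and> j \<le> b" if "(i, j) \<in> E - {(a, b)}" for i j
    using that D(2)[of i j] by auto
  show False if "(i, j) \<in> E - {(a, b)}" "(k, l) \<in> E - {(a, b)}" "i < k" "k < j" "j < l" for i j k l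
    using that D(4)[of i j k l] by auto
qed (use assms(2) arc_systemD(3)[OF assms(1)] in auto)

text \<open>Existence and uniqueness of the central polygon.\<close>

lemma spine_face:
  assumes E: "arc_system a b E" and "a < b" and nE: "(a, b) \<notin> E"
  shows "F \<in> polys (insert (a, b) E) \<and> (a, b) \<in> sides F \<longleftrightarrow> F = spine a b E"
proof
  let ?E = "insert (a, b) E"
  assume *: "F \<in> polys ?E \<and> (a, b) \<in> sides F"
  have F: "a \<in> F" "b \<in> F" "F \<subseteq> {a..b}"
    using * polys_subset(1)[OF arc_system_insert_roof[OF E \<open>a < b\<close>]] by (auto simp: sides_def)
  have s: "sides F = insert (a, b) (steps F)" by (rule sides_eq_insert_steps) (use F \<open>a < b\<close> in auto)
  have c3: "3 \<le> card F" and eq: "segments F \<inter> ?E = sides F" using * by (auto simp: polys_def)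
  \<comment> \<open>A third vertex of \<open>F\<close> lies strictly between \<open>a\<close> and
    \<open>b\<close>, so the roof is a side of \<open>F\<close> without being a step.\<close>
  have "(a, b) \<notin> steps F"
  proof
    assume "(a, b) \<in> steps F"
    then have "F \<subseteq> {a, b}" using F by (fastforce simp: steps_def)
    then have "card F \<le> card {a, b}" by (intro card_mono) auto
    then show False using c3 \<open>a < b\<close> by simp
  qed
  moreover have "steps F \<subseteq> segments F"
    using steps_subset_sides sides_subset_segments by blast
  ultimately have "segments F \<inter> E = steps F" using eq s nE by auto
  then show "F = spine a b E" using spine_unique[OF E F] by simp
next
  let ?F = "spine a b E"
  assume *: "F = ?F"
  have F: "a \<in> ?F" "b \<in> ?F" "?F \<subseteq> {a..b}" using ends_in_spine[OF E] spine_subset by auto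
  have s: "sides ?F = insert (a, b) (steps ?F)"
    by (rule sides_eq_insert_steps) (use F \<open>a < b\<close> in auto)
  have "3 \<le> card ?F"
    using card_spine_ge_2[OF E \<open>a < b\<close>] card_spine_eq_2_iff[OF E \<open>a < b\<close>] nE by linarith
  moreover have "(a, b) \<in> segments ?F" using F \<open>a < b\<close> by (auto simp: segments_def)
  ultimately show "F \<in> polys (insert (a, b) E) \<and> (a, b) \<in> sides F"
    using s segments_spine_inter[OF E] * by (auto simp: polys_def)
qed

text \<open>Faces that do not have the roof as a side are unaffected by it, and the only face that
  has it as a side is the spine.\<close>

lemma polys_insert_roof:
  assumes E: "arc_system a b E" and "a < b" and nE: "(a, b) \<notin> E"
  shows "polys (insert (a, b) E) = insert (spine a b E) (polys E)" "spine a b E \<notin> polys E"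
proof -
  let ?E = "insert (a, b) E"
  have 1: "(F \<in> polys ?E \<and> (a, b) \<notin> sides F) \<longleftrightarrow> F \<in> polys E" for F
  proof
    assume "F \<in> polys ?E \<and> (a, b) \<notin> sides F"
    then show "F \<in> polys E" using sides_subset_segments by (fastforce simp: polys_def)
  next
    assume F: "F \<in> polys E"
    have "F \<subseteq> {a..b}" using polys_subset(1)[OF E F] .
    have ns: "(a, b) \<notin> sides F" using F nE by (auto simp: polys_def)
    \<comment> \<open>Inside \<open>{a..b}\<close> a segment from \<open>a\<close> to
      \<open>b\<close> is always a side, never a diagonal.\<close>
    have "(a, b) \<notin> segments F"
      using ns \<open>F \<subseteq> {a..b}\<close> by (auto simp: segments_def sides_def)
    then show "F \<in> polys ?E \<and> (a, b) \<notin> sides F" using F ns by (auto simp: polys_def)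
  qed
  show "polys ?E = insert (spine a b E) (polys E)"
    using 1 spine_face[OF E \<open>a < b\<close> nE] by blast
  show "spine a b E \<notin> polys E"
    using 1 spine_face[OF E \<open>a < b\<close> nE] by blast
qed

lemma face_type_insert_roof:
  assumes "arc_system a b E" "a < b" "(a, b) \<notin> E"
  shows "face_type (insert (a, b) E) =
    face_type E + Poly_Mapping.single (card (spine a b E) - 1) 1"
  unfolding face_type_def polys_insert_roof(1)[OF assms]
  using polys_insert_roof(2)[OF assms] finite_polys[OF assms(1)] by (simp add: add.commute)

section \<open>Euler's relation\<close>

lemma face_type_short:
  assumes E: "arc_system a b E" and "b \<le> a + 1"
  shows "face_type E = 0"
proof -
  have "polys E = {}"
  proof (rule ccontr)
    assume "polys E \<noteq> {}"
    then obtain F where F: "F \<in> polys E" by auto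
    have "card F \<le> card {a..b}" by (rule card_mono) (use polys_subset(1)[OF E F] in auto)
    moreover have "3 \<le> card F" using F by (simp add: polys_def)
    ultimately show False using \<open>b \<le> a + 1\<close> by simp
  qed
  then show ?thesis by (simp add: face_type_def)
qed

text \<open>Induction on the number of segments. Deleting the roof replaces a spine of 2 vertices by
  one of \<open>s\<close> vertices and loses an \<open>s\<close>-gon, whose weight is
  \<open>s - 2\<close>. Without the roof, the system is cut at its second spine vertex and the
  relations of both parts are added.\<close>

lemma arc_system_vertex_count:
  assumes "arc_system a b E"
  shows "b + 1 = a + card (spine a b E) + weight (face_type E)"
  using assms
proof (induction "card E" arbitrary: a b E rule: less_induct)
  case less
  note E = less.prems
  have fin: "finite E" by (rule arc_system_finite[OF E])
  \<comment> \<open>A roof of length 1 is a unit segment and cannot be deleted, so it is a base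
    case.\<close>
  consider "a = b" | "a < b" "(a, b) \<in> E" "b = a + 1" | "(a, b) \<in> E" "a + 2 \<le> b" | "a < b" "(a, b) \<notin> E"
    using arc_systemD(1)[OF E] by linarith
  then show ?case
  proof cases
    case 1
    then have "spine a b E = {a}" using ends_in_spine[OF E] spine_subset[of a b E] by auto
    then show ?thesis using face_type_short[OF E] 1 by simp
  next
    case 2
    then show ?thesis using face_type_short[OF E] card_spine_eq_2_iff[OF E] by simp
  next
    case 3
    let ?E = "E - {(a, b)}"
    have E': "arc_system a b ?E" and ab: "a < b" using arc_system_remove_roof[OF E] 3 by auto
    have "card ?E < card E" using fin 3 by (intro psubset_card_mono) auto
    then have "b + 1 = a + card (spine a b ?E) + weight (face_type ?E)" using less.hyps E' by blast
    moreover have "face_type E = face_type ?E + Poly_Mapping.single (card (spine a b ?E) - 1) 1"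
      using face_type_insert_roof[OF E' ab] 3 by (simp add: insert_absorb)
    \<comment> \<open>Makes the truncated subtraction in the weight of the lost face exact.\<close>
    moreover have "2 \<le> card (spine a b ?E)" by (rule card_spine_ge_2[OF E' ab])
    ultimately show ?thesis using card_spine_eq_2_iff[OF E ab] 3 by simp
  next
    case 4
    obtain c L R where LR: "E = L \<union> R" "arc_system a c L" "(a, c) \<in> L" "arc_system c b R"
      using arc_system_split_first[OF E 4(1)] .
    have ac: "a < c" using arc_systemD(2)[OF LR(2,3)] by simp
    have "c \<noteq> b" using LR 4 by auto
    then have cb: "c < b" using arc_systemD(1)[OF LR(4)] by simp
    have "(c, Suc c) \<in> E - L" using arc_systemD(3)[OF LR(4), of c] arc_systemD(2)[OF LR(2)] cb LR(1) by fastforce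
    then have "L \<subset> E" using LR(1) by auto
    moreover have "(a, c) \<in> E - R" using arc_systemD(2)[OF LR(4)] ac LR(1,3) by fastforce
    then have "R \<subset> E" using LR(1) by auto
    ultimately have "card L < card E" "card R < card E" using fin by (auto intro: psubset_card_mono)
    then have "c + 1 = a + card (spine a c L) + weight (face_type L)"
      "b + 1 = c + card (spine c b R) + weight (face_type R)"
      using less.hyps LR by blast+
    moreover have "card (spine a c L) = 2" using card_spine_eq_2_iff[OF LR(2) ac] LR(3) by simp
    moreover have "card (spine a b E) = Suc (card (spine c b R))"
    proof -
      have "a \<notin> spine c b R" using ac by (auto simp: spine_def)
      then show ?thesis using spine_union[OF LR(2-4)] LR(1) finite_spine by simp
    qed
    ultimately show ?thesis using face_type_union[OF LR(2,4)] LR(1) by simp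
  qed
qed

section \<open>Face counts by size\<close>

lemma lookup_face_type:
  assumes "arc_system a b E"
  shows "Poly_Mapping.lookup (face_type E) k = card {F \<in> polys E. card F = k + 1}"
proof -
  have "Poly_Mapping.lookup (face_type E) k = (\<Sum>F\<in>polys E. if card F = k + 1 then 1 else 0)"
    unfolding face_type_def lookup_sum
    \<comment> \<open>\<open>card F - 1 = k\<close> and \<open>card F = k + 1\<close> agree because
      \<open>card F\<close> is at least 3.\<close>
    by (rule sum.cong) (auto simp: lookup_single when_def polys_def)
  also have "\<dots> = card {F \<in> polys E. card F = k + 1}"
    using finite_polys[OF assms] by (simp flip: sum.inter_filter)
  finally show ?thesis .
qed

lemma face_type_is_type:
  assumes "arc_system a b E"
  shows "is_type (face_type E)"
proof -
  have "{F \<in> polys E. card F = k + 1} = {}" if "k < 2" for k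
    using that by (auto simp: polys_def)
  then have "Poly_Mapping.lookup (face_type E) k = 0" if "k < 2" for k
    using lookup_face_type[OF assms, of k] that by (metis card.empty)
  then show ?thesis
    unfolding is_type_def by (metis atLeast_iff in_keys_iff not_le subsetI)
qed

section \<open>Translation invariance\<close>

abbreviation shift :: "nat \<Rightarrow> nat \<times> nat \<Rightarrow> nat \<times> nat" where
  "shift c \<equiv> map_prod ((+) c) ((+) c)"

lemma inj_shift: "inj (shift c)"
  by (rule prod.inj_map) auto

lemma arc_system_shift:
  assumes "arc_system a b E"
  shows "arc_system (c + a) (c + b) (shift c ` E)"
proof (rule arc_systemI)
  note D = arc_systemD[OF assms]
  show "c + a \<le> c + b" using D(1) by simp
  show "c + a \<le> i \<and> i < j \<and> j \<le> c + b" if "(i, j) \<in> shift c ` E" for i j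
    using that D(2) by auto
  show "(i, Suc i) \<in> shift c ` E" if "c + a \<le> i" "i < c + b" for i
  proof -
    have "(i, Suc i) = shift c (i - c, Suc (i - c))" using that by auto
    moreover have "(i - c, Suc (i - c)) \<in> E" using that by (intro D(3)) auto
    ultimately show ?thesis by (rule image_eqI)
  qed
  show False if "(i, j) \<in> shift c ` E" "(k, l) \<in> shift c ` E" "i < k" "k < j" "j < l" for i j k l
    using that D(4) by auto
qed

lemma arc_system_unshift:
  assumes "arc_system (c + a) (c + b) E"
  shows "arc_system a b (shift c -` E)" "shift c ` (shift c -` E) = E"
proof -
  note D = arc_systemD[OF assms]
  show "arc_system a b (shift c -` E)"
  proof (rule arc_systemI)
    show "a \<le> i \<and> i < j \<and> j \<le> b" if "(i, j) \<in> shift c -` E" for i j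
      using that D(2)[of "c + i" "c + j"] by auto
    show "(i, Suc i) \<in> shift c -` E" if "a \<le> i" "i < b" for i
      using D(3)[of "c + i"] that by simp
    show False if "(i, j) \<in> shift c -` E" "(k, l) \<in> shift c -` E" "i < k" "k < j" "j < l" for i j k l
      using that D(4)[of "c + i" "c + j" "c + k" "c + l"] by simp
  qed (use D(1) in simp)
  have "(i, j) \<in> range (shift c)" if "(i, j) \<in> E" for i j
  proof -
    have "(i, j) = shift c (i - c, j - c)" using D(2)[OF that] by auto
    then show ?thesis by blast
  qed
  then have "E \<subseteq> range (shift c)" by auto
  then show "shift c ` (shift c -` E) = E" by auto
qed

lemma segments_shift: "segments ((+) c ` F) = shift c ` segments F"
  by (auto simp: segments_def image_iff)

lemma sides_shift: "sides ((+) c ` F) = shift c ` sides F"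
  by (auto simp: sides_def image_iff)

lemma polys_shift_iff: "(+) c ` F \<in> polys (shift c ` E) \<longleftrightarrow> F \<in> polys E"
proof -
  have "card ((+) c ` F) = card F" by (rule card_image) simp
  moreover have "segments ((+) c ` F) \<inter> shift c ` E = shift c ` (segments F \<inter> E)"
    by (simp add: segments_shift image_Int[OF inj_shift])
  ultimately show ?thesis
    by (simp add: polys_def sides_shift inj_image_eq_iff[OF inj_shift])
qed

lemma face_type_shift:
  assumes E: "arc_system a b E"
  shows "face_type (shift c ` E) = face_type E"
proof -
  have "polys (shift c ` E) = (`) ((+) c) ` polys E"
  proof (intro equalityI subsetI)
    fix F assume F: "F \<in> polys (shift c ` E)"
    then have "F \<subseteq> (+) c ` {a..b}"
      using polys_subset(1)[OF arc_system_shift[OF E] F] by (simp add: add.commute)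
    then obtain G where "F = (+) c ` G" by (rule subset_imageE)
    then show "F \<in> (`) ((+) c) ` polys E" using F polys_shift_iff by auto
  qed (use polys_shift_iff in auto)
  moreover have "inj_on ((`) ((+) c)) (polys E)"
    by (rule inj_onI) (simp add: inj_image_eq_iff)
  moreover have "card ((+) c ` F) = card F" for F by (rule card_image) simp
  ultimately show ?thesis
    by (simp add: face_type_def sum.reindex)
qed

lemma systems_1:
  "systems (Suc 0) a n = {E. arc_system a (a + 1 + weight n) E \<and> (a, a + 1 + weight n) \<in> E \<and>
     face_type E = n}"
  using card_spine_eq_2_iff[of a "a + 1 + weight n"] by (auto simp: systems_def numeral_2_eq_2)

text \<open>Subdigons live on intervals starting at 0, whereas the parts of a cut system start at
  other vertices.\<close>

lemma card_systems_1_shift: "card (systems (Suc 0) a n) = card (systems (Suc 0) 0 n)"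
proof -
  let ?b = "1 + weight n"
  have "bij_betw ((`) (shift a)) (systems (Suc 0) 0 n) (systems (Suc 0) a n)"
  proof (rule bij_betw_imageI)
    show "inj_on ((`) (shift a)) (systems (Suc 0) 0 n)"
      by (rule inj_onI) (simp add: inj_image_eq_iff[OF inj_shift])
    show "(`) (shift a) ` systems (Suc 0) 0 n = systems (Suc 0) a n"
    proof (intro equalityI subsetI)
      fix E' assume "E' \<in> (`) (shift a) ` systems (Suc 0) 0 n"
      then obtain E where E: "E' = shift a ` E" "arc_system 0 ?b E" "(0, ?b) \<in> E" "face_type E = n"
        by (auto simp: systems_1)
      have "(a, a + ?b) \<in> E'" using E(1) imageI[OF E(3), of "shift a"] by simp
      then show "E' \<in> systems (Suc 0) a n"
        using arc_system_shift[OF E(2), of a] face_type_shift[OF E(2), of a] E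
        by (simp add: systems_1 add.assoc)
    next
      fix E' assume "E' \<in> systems (Suc 0) a n"
      then have E: "arc_system (a + 0) (a + ?b) E'" "(a, a + ?b) \<in> E'" "face_type E' = n"
        by (auto simp: systems_1 add.assoc)
      let ?E = "shift a -` E'"
      have "face_type ?E = n"
        using face_type_shift[OF arc_system_unshift(1)[OF E(1)], of a]
          arc_system_unshift(2)[OF E(1)] E(3) by simp
      then have "?E \<in> systems (Suc 0) 0 n"
        using arc_system_unshift(1)[OF E(1)] E(2) by (simp add: systems_1)
      then show "E' \<in> (`) (shift a) ` systems (Suc 0) 0 n"
        using arc_system_unshift(2)[OF E(1)] by (metis imageI)
    qed
  qed
  then show ?thesis by (simp add: bij_betw_same_card)
qed

section \<open>Subdigons as arc systems with a roof\<close>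

lemma sides_inter_segments: "F \<subseteq> G \<Longrightarrow> segments F \<inter> sides G \<subseteq> sides F"
  by (auto simp: segments_def sides_def)

lemma lessThan_Suc_eq: "{..<Suc b} = {0..b}"
  by auto

lemma dissection_arc_system:
  assumes D: "dissection (Suc b) D" and "0 < b"
  shows "arc_system 0 b (D \<union> sides {0..b})"
proof (rule arc_systemI)
  note s = sides_interval[OF \<open>0 < b\<close>]
  have d: "(i, j) \<notin> sides {0..b} \<and> i < j \<and> j \<le> b" if "(i, j) \<in> D" for i j
    using D that by (auto simp: dissection_def diagonals_def lessThan_Suc_eq)
  show bd: "0 \<le> i \<and> i < j \<and> j \<le> b" if "(i, j) \<in> D \<union> sides {0..b}" for i j
    using that d[of i j] \<open>0 < b\<close> by (auto simp: s)
  show "(i, Suc i) \<in> D \<union> sides {0..b}" if "0 \<le> i" "i < b" for i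
    using that by (auto simp: s)
  show False if *: "(i, j) \<in> D \<union> sides {0..b}" "(k, l) \<in> D \<union> sides {0..b}"
    "i < k" "k < j" "j < l" for i j k l
  proof -
    \<comment> \<open>Sides cross nothing: a unit segment has no vertex strictly inside, and the
      roof has none outside.\<close>
    have "(i, j) \<in> D" "(k, l) \<in> D" using * bd[OF *(2)] by (auto simp: s)
    moreover have "crossing (i, j) (k, l)" using * by (simp add: crossing_def)
    ultimately show False using D unfolding dissection_def by blast
  qed
qed simp

lemma arc_system_dissection:
  assumes E: "arc_system 0 b E" and "(0, b) \<in> E"
  shows "dissection (Suc b) (E - sides {0..b})" "sides {0..b} \<subseteq> E"
proof -
  have "0 < b" using arc_systemD(2)[OF assms] by simp
  show "sides {0..b} \<subseteq> E"
    using sides_interval[OF \<open>0 < b\<close>] assms(2) arc_systemD(3)[OF E] by auto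
  show "dissection (Suc b) (E - sides {0..b})"
    using E unfolding dissection_def arc_system_def diagonals_eq lessThan_Suc_eq by blast
qed

text \<open>A side of the big polygon joining two vertices of \<open>F\<close> is a side of
  \<open>F\<close>, so adjoining these sides adds no diagonal of \<open>F\<close>.\<close>

lemma faces_eq_polys:
  assumes D: "dissection (Suc b) D" and "0 < b"
  shows "faces (Suc b) D = polys (D \<union> sides {0..b})"
proof -
  let ?E = "D \<union> sides {0..b}"
  have sub: "F \<subseteq> {0..b}" if "F \<in> polys ?E" for F
    by (rule polys_subset(1)[OF dissection_arc_system[OF assms] that])
  have "sides F \<subseteq> sides {0..b} \<union> D \<and> diagonals F \<inter> D = {} \<longleftrightarrow> segments F \<inter> ?E = sides F"
    if "F \<subseteq> {0..b}" for F
    using sides_inter_segments[OF that] sides_subset_segments[of F] unfolding diagonals_eq by blast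
  then have "F \<in> faces (Suc b) D \<longleftrightarrow> F \<subseteq> {0..b} \<and> F \<in> polys ?E" for F
    unfolding faces_def lessThan_Suc_eq polys_def mem_Collect_eq by metis
  then show ?thesis using sub by blast
qed

text \<open>Adjoining the sides is undone by removing them, since a dissection consists of
  diagonals. The null subdigon becomes the single segment \<open>(0, 1)\<close>.\<close>

lemma bij_betw_subdigons:
  assumes "is_type n"
  shows "bij_betw (\<lambda>D. D \<union> sides {0..1 + weight n}) (subdigons n) (systems (Suc 0) 0 n)"
proof -
  define b where "b = 1 + weight n"
  have b: "num_vertices n = Suc b" "0 < b" by (auto simp: b_def num_vertices_eq_weight)
  have ty: "(\<forall>k\<ge>2. card {F \<in> faces (Suc b) D. card F = k + 1} = Poly_Mapping.lookup n k) \<longleftrightarrow>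
      face_type (D \<union> sides {0..b}) = n" if D: "dissection (Suc b) D" for D
  proof -
    let ?E = "D \<union> sides {0..b}"
    have E: "arc_system 0 b ?E" by (rule dissection_arc_system[OF D b(2)])
    \<comment> \<open>\<open>subdigons\<close> constrains only the entries with
      \<open>k \<ge> 2\<close>. The others vanish because both vectors are types.\<close>
    have small: "Poly_Mapping.lookup (face_type ?E) k = Poly_Mapping.lookup n k" if "k < 2" for k
    proof -
      have "k \<notin> Poly_Mapping.keys (face_type ?E)" "k \<notin> Poly_Mapping.keys n"
        using assms face_type_is_type[OF E] that by (auto simp: is_type_def)
      then show ?thesis by (simp add: in_keys_iff)
    qed
    show ?thesis unfolding faces_eq_polys[OF D b(2)] lookup_face_type[OF E, symmetric]
      using small by (metis not_le poly_mapping_eqI)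
  qed
  have sub: "subdigons n = {D. dissection (Suc b) D \<and> face_type (D \<union> sides {0..b}) = n}"
    unfolding subdigons_def b(1) using ty by blast
  have sys: "systems (Suc 0) 0 n = {E. arc_system 0 b E \<and> (0, b) \<in> E \<and> face_type E = n}"
    unfolding systems_1 by (simp add: b_def)
  have disj: "D \<inter> sides {0..b} = {}" if "dissection (Suc b) D" for D
    using that by (auto simp: dissection_def diagonals_eq lessThan_Suc_eq)
  show ?thesis unfolding sub sys b_def[symmetric]
  proof (rule bij_betw_byWitness[where f' = "\<lambda>E. E - sides {0..b}"])
    have "(0, b) \<in> sides {0..b}" using b(2) by (auto simp: sides_def)
    then show "(\<lambda>D. D \<union> sides {0..b}) ` {D. dissection (Suc b) D \<and> face_type (D \<union> sides {0..b}) = n}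
        \<subseteq> {E. arc_system 0 b E \<and> (0, b) \<in> E \<and> face_type E = n}"
      using dissection_arc_system b(2) by auto
    have "E - sides {0..b} \<union> sides {0..b} = E" if "arc_system 0 b E" "(0, b) \<in> E" for E
      using arc_system_dissection(2)[OF that] by blast
    note un = this
    then show "\<forall>E\<in>{E. arc_system 0 b E \<and> (0, b) \<in> E \<and> face_type E = n}.
        E - sides {0..b} \<union> sides {0..b} = E" by blast
    show "(\<lambda>E. E - sides {0..b}) ` {E. arc_system 0 b E \<and> (0, b) \<in> E \<and> face_type E = n}
        \<subseteq> {D. dissection (Suc b) D \<and> face_type (D \<union> sides {0..b}) = n}"
      using arc_system_dissection(1) un by auto
  qed (use disj in blast)
qed

lemma subdigon_series_eq_card: "subdigon_series n = card (systems (Suc 0) a n)"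
proof (cases "is_type n")
  case True
  then show ?thesis
    using bij_betw_same_card[OF bij_betw_subdigons[OF True]] card_systems_1_shift[of a n]
    by (simp add: subdigon_series_def)
next
  case False
  \<comment> \<open>Face types are always types, so both sides are 0 for any other exponent
    vector.\<close>
  then have "systems (Suc 0) a n = {}" using face_type_is_type by (auto simp: systems_def)
  then show ?thesis using False by (simp add: subdigon_series_def)
qed

section \<open>The recursion for powers of the series\<close>

lemma finite_systems: "finite (systems r a n)"
  by (rule finite_subset[of _ "Pow ({a..a + r + weight n} \<times> {a..a + r + weight n})"])
    (auto simp: systems_def arc_system_def segments_def)

text \<open>A spine without steps is a single vertex, so the interval has length 0. This is the
  counterpart of \<open>mfps_one\<close>.\<close>

lemma systems_0: "systems 0 a n = (if n = 0 then {{}} else {})"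
proof -
  have "E = {} \<and> n = 0" if "E \<in> systems 0 a n" for E
  proof -
    let ?b = "a + weight n"
    have E: "arc_system a ?b E" "card (spine a ?b E) = 1" "face_type E = n"
      using that by (auto simp: systems_def)
    have w: "weight n = 0"
      using card_spine_ge_2[OF E(1)] E(2) by (cases "weight n = 0") auto
    have "(i, j) \<notin> E" for i j using arc_systemD(2)[OF E(1), of i j] w by auto
    then show ?thesis using face_type_short[OF E(1)] w E(3) by auto
  qed
  moreover have "{} \<in> systems 0 a 0"
  proof -
    have A: "arc_system a a {}" by (rule arc_systemI) auto
    moreover have "spine a a {} = {a}" by (auto simp: spine_def)
    ultimately show ?thesis using face_type_short[OF A] by (simp add: systems_def)
  qed
  ultimately show ?thesis by auto
qed

text \<open>Both parts of the cut at the second spine vertex are again systems for their own types.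
  By Euler's relation the type of the left part determines the position of the cut, so a splitting
  of \<open>n\<close> fixes both intervals.\<close>

lemma bij_betw_systems_Suc:
  "bij_betw (\<lambda>(p, L, R). L \<union> R)
     (SIGMA p:{(x, y). x + y = n}. systems (Suc 0) a (fst p) \<times> systems r (a + 1 + weight (fst p)) (snd p))
     (systems (Suc r) a n)"
proof (rule bij_betw_imageI)
  let ?A = "SIGMA p:{(x, y). x + y = n}. systems (Suc 0) a (fst p) \<times> systems r (a + 1 + weight (fst p)) (snd p)"
  let ?f = "\<lambda>(p, L, R). L \<union> R"
  let ?b = "a + Suc r + weight n"
  have A: "(a, a + 1 + weight x) \<in> L \<and> arc_system a (a + 1 + weight x) L \<and>
      arc_system (a + 1 + weight x) ?b R \<and> card (spine (a + 1 + weight x) ?b R) = r + 1 \<and>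
      x = face_type L \<and> y = face_type R"
    if "((x, y), L, R) \<in> ?A" for x y L R
  proof -
    have "a + 1 + weight x + r + weight y = ?b" using that by auto
    moreover have "L \<in> systems (Suc 0) a x" "R \<in> systems r (a + 1 + weight x) y"
      using that by auto
    ultimately show ?thesis unfolding systems_1 systems_def[of r] by (metis (mono_tags) mem_Collect_eq)
  qed
  show "inj_on ?f ?A"
  proof (rule inj_onI)
    fix z z' assume zz: "z \<in> ?A" "z' \<in> ?A" "?f z = ?f z'"
    obtain x y L R where z: "z = ((x, y), L, R)" by (metis surj_pair)
    obtain x' y' L' R' where z': "z' = ((x', y'), L', R')" by (metis surj_pair)
    have p: "((x, y), L, R) \<in> ?A" and p': "((x', y'), L', R') \<in> ?A" and eq: "L \<union> R = L' \<union> R'"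
      using zz unfolding z z' by simp_all
    \<comment> \<open>The cut can be recovered from the union as the first spine vertex after
      \<open>a\<close>, and the parts are the segments on either side of it.\<close>
    have key: "a + 1 + weight x = Min (spine a ?b (L \<union> R) - {a}) \<and>
       L = {(i, j) \<in> L \<union> R. j \<le> a + 1 + weight x} \<and> R = {(i, j) \<in> L \<union> R. a + 1 + weight x \<le> i}"
      if "((x, y), L, R) \<in> ?A" for x y L R
    proof -
      define c where "c = a + 1 + weight x"
      have L: "arc_system a c L" "(a, c) \<in> L" and R: "arc_system c ?b R"
        using A[OF that] by (auto simp: c_def)
      have "a \<notin> spine c ?b R" by (auto simp: spine_def c_def)
      then have "spine a ?b (L \<union> R) - {a} = spine c ?b R"
        using spine_union[OF L R] by auto
      moreover have "Min (spine c ?b R) = c"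
        by (rule Min_eqI[OF finite_spine]) (use ends_in_spine[OF R] in \<open>auto simp: spine_def\<close>)
      moreover have "i < j \<and> j \<le> c" if "(i, j) \<in> L" for i j using arc_systemD(2)[OF L(1) that] by simp
      moreover have "i < j \<and> c \<le> i" if "(i, j) \<in> R" for i j using arc_systemD(2)[OF R that] by simp
      ultimately show ?thesis unfolding c_def[symmetric] by fastforce
    qed
    have c: "a + 1 + weight x = a + 1 + weight x'" using key[OF p] key[OF p'] eq by simp
    have "L = L'" "R = R'" using key[OF p] key[OF p'] unfolding eq c by blast+
    then show "z = z'" using A[OF p] A[OF p'] unfolding z z' by simp
  qed
  show "?f ` ?A = systems (Suc r) a n"
  proof (intro equalityI subsetI)
    fix E assume "E \<in> ?f ` ?A"
    then obtain x y L R where p: "((x, y), L, R) \<in> ?A" and E: "E = L \<union> R" by force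
    define c where "c = a + 1 + weight x"
    have L: "arc_system a c L" "(a, c) \<in> L" and R: "arc_system c ?b R" "card (spine c ?b R) = r + 1"
      using A[OF p] by (auto simp: c_def)
    have "a \<notin> spine c ?b R" by (auto simp: spine_def c_def)
    then have "card (spine a ?b E) = Suc r + 1"
      using spine_union[OF L R(1)] R(2) E finite_spine by simp
    moreover have "face_type E = n"
      using face_type_union[OF L(1) R(1)] A[OF p] p E by simp
    ultimately show "E \<in> systems (Suc r) a n"
      using arc_system_union[OF L(1) R(1)] E by (simp add: systems_def)
  next
    fix E assume "E \<in> systems (Suc r) a n"
    then have E: "arc_system a ?b E" "card (spine a ?b E) = Suc r + 1" "face_type E = n"
      by (auto simp: systems_def)
    have "a < ?b" by simp
    obtain c L R where LR: "E = L \<union> R" "arc_system a c L" "(a, c) \<in> L" "arc_system c ?b R"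
      using arc_system_split_first[OF E(1) \<open>a < ?b\<close>] .
    have ac: "a < c" using arc_systemD(2)[OF LR(2,3)] by simp
    have L2: "card (spine a c L) = 2" using card_spine_eq_2_iff[OF LR(2) ac] LR(3) by simp
    \<comment> \<open>Euler's relation for the left part, whose spine has two vertices.\<close>
    have c: "c = a + 1 + weight (face_type L)" using arc_system_vertex_count[OF LR(2)] L2 by simp
    have "a \<notin> spine c ?b R" using ac by (auto simp: spine_def)
    then have R2: "card (spine c ?b R) = r + 1"
      using spine_union[OF LR(2-4)] E(2) LR(1) finite_spine by simp
    have n: "face_type L + face_type R = n" using face_type_union[OF LR(2,4)] E(3) LR(1) by simp
    have b: "?b = c + r + weight (face_type R)" using c n weight_add[of "face_type L" "face_type R"] by simp
    have "L \<in> systems (Suc 0) a (face_type L)" using LR(2,3) c by (simp add: systems_1)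
    moreover have "R \<in> systems r (a + 1 + weight (face_type L)) (face_type R)"
      using LR(4) R2 unfolding systems_def c[symmetric] b[symmetric] by simp
    ultimately have "((face_type L, face_type R), L, R) \<in> ?A" using n by simp
    moreover have "E = ?f ((face_type L, face_type R), L, R)" using LR(1) by simp
    ultimately show "E \<in> ?f ` ?A" by (rule rev_image_eqI)
  qed
qed

text \<open>The splittings in the preceding bijection are those of the Cauchy product. The start
  \<open>a\<close> is generalised because the right factor begins at the cut.\<close>

lemma mfps_power_eq_card: "mfps_power subdigon_series r n = card (systems r a n)"
proof (induction r arbitrary: a n)
  case 0
  then show ?case by (simp add: mfps_one_def systems_0)
next
  case (Suc r)
  let ?S = "\<lambda>p. systems (Suc 0) a (fst p) \<times> systems r (a + 1 + weight (fst p)) (snd p)"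
  have "card (systems (Suc r) a n) = card (SIGMA p:{(x, y). x + y = n}. ?S p)"
    using bij_betw_same_card[OF bij_betw_systems_Suc] by simp
  also have "\<dots> = (\<Sum>p\<in>{(x, y). x + y = n}. card (?S p))"
    using finite_splittings[of n] finite_systems
    by (intro card_SigmaI) auto
  also have "\<dots> = (\<Sum>p\<in>{(x, y). x + y = n}.
      subdigon_series (fst p) * mfps_power subdigon_series r (snd p))"
    by (intro sum.cong refl) (simp only: card_cartesian_product Suc.IH[symmetric] subdigon_series_eq_card[symmetric])
  also have "\<dots> = mfps_power subdigon_series (Suc r) n"
    by (simp add: mfps_mult_def case_prod_beta)
  finally show ?case by simp
qed

section \<open>Central polygons and the spine\<close>

text \<open>The roof closes a spine of \<open>r\<close> steps to an \<open>(r + 1)\<close>-gon,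
  which raises the entry of the type at \<open>r\<close> by one.\<close>

lemma bij_betw_insert_roof:
  fixes r :: nat and m :: "nat \<Rightarrow>\<^sub>0 nat"
  assumes "r \<ge> 2"
  defines "b \<equiv> r + weight m"
  shows "bij_betw (insert (0, b)) (systems r 0 m)
    {E \<in> systems (Suc 0) 0 (m + Poly_Mapping.single r 1). card (spine 0 b (E - {(0, b)})) = r + 1}"
proof -
  \<comment> \<open>The interval stays the same: the spine shrinks from \<open>r\<close> steps to
    one, while the new face adds \<open>r - 1\<close> to the weight.\<close>
  have b: "0 < b" "0 + 2 \<le> b" "0 + 1 + weight (m + Poly_Mapping.single r 1) = b"
    using assms by (auto simp: b_def)
  have sys: "systems r 0 m = {E. arc_system 0 b E \<and> card (spine 0 b E) = r + 1 \<and> face_type E = m}"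
    by (simp add: systems_def b_def)
  have sys1: "systems (Suc 0) 0 (m + Poly_Mapping.single r 1) =
      {E. arc_system 0 b E \<and> (0, b) \<in> E \<and> face_type E = m + Poly_Mapping.single r 1}"
    unfolding systems_1 b(3) by simp
  \<comment> \<open>The spine has \<open>r + 1\<close>, hence at least 3, vertices.\<close>
  have nr: "(0, b) \<notin> E" if "E \<in> systems r 0 m" for E
    using that card_spine_eq_2_iff[of 0 b E] b(1) assms(1) by (auto simp: sys)
  show ?thesis
  proof (rule bij_betw_byWitness[where f' = "\<lambda>E. E - {(0, b)}"])
    show "\<forall>E\<in>systems r 0 m. insert (0, b) E - {(0, b)} = E" using nr by auto
    show "insert (0, b) ` systems r 0 m \<subseteq>
      {E \<in> systems (Suc 0) 0 (m + Poly_Mapping.single r 1). card (spine 0 b (E - {(0, b)})) = r + 1}"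
    proof (rule image_subsetI)
      fix E assume E: "E \<in> systems r 0 m"
      note nr = nr[OF E]
      from E have E: "arc_system 0 b E" "card (spine 0 b E) = r + 1" "face_type E = m"
        by (auto simp: sys)
      show "insert (0, b) E \<in> {E \<in> systems (Suc 0) 0 (m + Poly_Mapping.single r 1).
          card (spine 0 b (E - {(0, b)})) = r + 1}"
        using arc_system_insert_roof[OF E(1) b(1)] face_type_insert_roof[OF E(1) b(1) nr] E nr
        unfolding sys1 by simp
    qed
    show "(\<lambda>E. E - {(0, b)}) ` {E \<in> systems (Suc 0) 0 (m + Poly_Mapping.single r 1).
        card (spine 0 b (E - {(0, b)})) = r + 1} \<subseteq> systems r 0 m"
    proof (rule image_subsetI)
      fix E assume "E \<in> {E \<in> systems (Suc 0) 0 (m + Poly_Mapping.single r 1).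
        card (spine 0 b (E - {(0, b)})) = r + 1}"
      then have E: "arc_system 0 b E" "(0, b) \<in> E" "face_type E = m + Poly_Mapping.single r 1"
        and c: "card (spine 0 b (E - {(0, b)})) = r + 1"
        unfolding sys1 by auto
      have E': "arc_system 0 b (E - {(0, b)})" by (rule arc_system_remove_roof[OF E(1) b(2)])
      have "face_type E = face_type (E - {(0, b)}) + Poly_Mapping.single r 1"
        using face_type_insert_roof[OF E' b(1)] E(2) c by (simp add: insert_absorb)
      then have "face_type (E - {(0, b)}) = m" using E(3) by simp
      then show "E - {(0, b)} \<in> systems r 0 m" using E' c unfolding sys by blast
    qed
  qed (unfold sys1, blast)
qed

text \<open>Exactly one face has the roof as a side, so the definite description denotes it.\<close>

lemma central_polygon_eq_spine:
  assumes D: "dissection (Suc b) D" and b: "2 \<le> b"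
  shows "central_polygon (Suc b) D = spine 0 b (D \<union> sides {0..b} - {(0, b)})"
proof -
  let ?E = "D \<union> sides {0..b}" and ?E' = "D \<union> sides {0..b} - {(0, b)}"
  have "0 < b" using b by simp
  have E': "arc_system 0 b ?E'"
    using arc_system_remove_roof[OF dissection_arc_system[OF D \<open>0 < b\<close>]] b by simp
  have "(0, b) \<in> ?E" using \<open>0 < b\<close> by (auto simp: sides_def)
  then have "insert (0, b) ?E' = ?E" by blast
  then have "F \<in> faces (Suc b) D \<and> roof (Suc b) \<in> sides F \<longleftrightarrow> F = spine 0 b ?E'" for F
    using spine_face[OF E' \<open>0 < b\<close>, of F] faces_eq_polys[OF D \<open>0 < b\<close>] by (simp add: roof_def)
  then show ?thesis unfolding central_polygon_def by simp
qed

theorem theorem6: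
  fixes r :: nat and m :: "nat \<Rightarrow>\<^sub>0 nat"
  assumes "r \<ge> 2" and "is_type m"
  shows "mfps_power subdigon_series r m =
    card {D \<in> subdigons (m + Poly_Mapping.single r 1).
      card (central_polygon (num_vertices (m + Poly_Mapping.single r 1)) D) = r + 1}"
proof -
  define n where "n = m + Poly_Mapping.single r 1"
  define b where "b = r + weight m"
  have bn: "1 + weight n = b" "num_vertices n = Suc b" "2 \<le> b"
    using assms(1) by (auto simp: n_def b_def num_vertices_eq_weight)
  have "is_type n"
    using assms keys_add[of m "Poly_Mapping.single r 1"] by (auto simp: is_type_def n_def)
  note bij = bij_betw_subdigons[OF this, unfolded bn(1)]
  have "(card (central_polygon (Suc b) D) = r + 1) \<longleftrightarrow>
      card (spine 0 b (D \<union> sides {0..b} - {(0, b)})) = r + 1" if "D \<in> subdigons n" for D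
    using central_polygon_eq_spine[of b D] that bn(2,3) by (simp add: subdigons_def)
  \<comment> \<open>The bijection for all subdigons of type \<open>n\<close> restricts to those with
    a central \<open>(r + 1)\<close>-gon.\<close>
  then have "(\<lambda>D. D \<union> sides {0..b}) ` {D \<in> subdigons n. card (central_polygon (Suc b) D) = r + 1}
      = {E \<in> systems (Suc 0) 0 n. card (spine 0 b (E - {(0, b)})) = r + 1}"
    unfolding bij_betw_imp_surj_on[OF bij, symmetric] by blast
  then have "bij_betw (\<lambda>D. D \<union> sides {0..b})
      {D \<in> subdigons n. card (central_polygon (Suc b) D) = r + 1}
      {E \<in> systems (Suc 0) 0 n. card (spine 0 b (E - {(0, b)})) = r + 1}"
    by (rule bij_betw_subset[OF bij, rotated]) blast
  from bij_betw_same_card[OF this]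
  have "card {D \<in> subdigons n. card (central_polygon (Suc b) D) = r + 1} = card (systems r 0 m)"
    using bij_betw_same_card[OF bij_betw_insert_roof[OF assms(1), of m]] by (simp add: n_def b_def)
  then show ?thesis
    using mfps_power_eq_card[of r m 0] bn(2) by (simp add: n_def)
qed

end
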